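(* Let $f,g:T\to X$ be $|RL|$ $m$-integrable functions on $T$ and let $\alpha\in\mathbb{R}$. Then: (a) $\alpha f$ is $|RL|$ $m$-integrable on $T$ and $(|RL|)\int_T \alpha f\,dm=\alpha\,(|RL|)\int_T f\,dm$. (b) If $\alpha\in[0,+\infty)$, then $f$ is $|RL|$ $\alpha m$-integrable on $T$ (where $(\alpha m)(A)=\alpha\, m(A)$ for $A\in\mathcal{A}$) and $(|RL|)\int_T f\,d(\alpha m)=\alpha\,(|RL|)\int_T f\,dm$. (c) $f+g$ and $f-g$ are $|RL|$ $m$-integrable on $T$ and $(|RL|)\int_T (f\pm g)\,dm=(|RL|)\int_T f\,dm\pm(|RL|)\int_T g\,dm$. The same statements (a), (b), (c) hold with $|RL|$ replaced by $RL$ throughout.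
   Context: $T$ is a nonempty, at least countable (i.e. infinite) set, $\mathcal{A}$ is a $\sigma$-algebra of subsets of $T$, $X$ is a real Banach space with norm $\|\cdot\|$, and $m:\mathcal{A}\to[0,+\infty)$ is an arbitrary set function with $m(\emptyset)=0$ (no additivity or monotonicity is assumed). A countable partition of $T$ is an at most countable family $\{A_n\}$ of pairwise disjoint nonempty sets of $\mathcal{A}$ with union $T$. For partitions $P,P'$ of $T$, write $P'\ge P$ ($P'$ finer than $P$) if every set of $P'$ is included in some set of $P$. A function $f:T\to X$ is absolutely (respectively unconditionally) Riemann-Lebesgue $m$-integrable on $T$, in short $|RL|$ (respectively $RL$) $m$-integrable, if there is $b\in X$ such that for every $\varepsilon>0$ there is a countable partition $P_\varepsilon$ of $T$ such that for every countable partition $P=\{A_n\}$ of $T$ with $P\ge P_\varepsilon$: $f$ is bounded on every $A_n$ with $m(A_n)>0$, and for every choice of points $t_n\in A_n$ the series $\sum_n f(t_n)m(A_n)$ is absolutely (respectively unconditionally) convergent and $\|\sum_n f(t_n)m(A_n)-b\|<\varepsilon$. The vector $b$ is unique and is denoted $(|RL|)\int_T f\,dm$ (respectively $(RL)\int_T f\,dm$). *)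

theory Defs
  imports
    "HOL-Analysis.Elementary_Metric_Spaces"
    "HOL-Analysis.Infinite_Sum"
    "HOL-Analysis.Sigma_Algebra"
    "HOL-Library.Disjoint_Sets"
begin

definition countable_partition :: "'a set \<Rightarrow> 'a set set \<Rightarrow> 'a set set \<Rightarrow> bool" where
  "countable_partition T \<A> P \<longleftrightarrow> countable P \<and> P \<subseteq> \<A> \<and> partition_on T P"

(* f is bounded on every member of P of positive m-value.  Functions on T are rendered as total
   functions on the ambient type; only their values on T are ever inspected. *)
definition bounded_on_parts ::
    "('a set \<Rightarrow> real) \<Rightarrow> ('a \<Rightarrow> 'b::banach) \<Rightarrow> 'a set set \<Rightarrow> bool" where
  "bounded_on_parts m f P \<longleftrightarrow> (\<forall>A\<in>P. m A > 0 \<longrightarrow> bounded (f ` A))"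

(* The members of a partition are pairwise distinct and a partition carries no preferred
   enumeration, so the series are indexed by the partition itself: a choice of points is a map t
   with t A \<in> A.  Absolute convergence is abs_summable_on; unconditional convergence is
   summable_on (convergence of the net of finite partial sums). In both cases the sum is
   infsum, and finite partitions are covered uniformly. "P \<ge> P\<^sub>0" is refines T P P\<^sub>0. *)

definition has_abs_RL_integral ::
    "'a set \<Rightarrow> 'a set set \<Rightarrow> ('a set \<Rightarrow> real) \<Rightarrow> ('a \<Rightarrow> 'b::banach) \<Rightarrow> 'b \<Rightarrow> bool" where
  "has_abs_RL_integral T \<A> m f b \<longleftrightarrow>
    (\<forall>\<epsilon>>0. \<exists>P\<^sub>0. countable_partition T \<A> P\<^sub>0 \<and>
      (\<forall>P. countable_partition T \<A> P \<and> refines T P P\<^sub>0 \<longrightarrow>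
        bounded_on_parts m f P \<and>
        (\<forall>t. (\<forall>A\<in>P. t A \<in> A) \<longrightarrow>
          (\<lambda>A. m A *\<^sub>R f (t A)) abs_summable_on P \<and>
          norm ((\<Sum>\<^sub>\<infinity>A\<in>P. m A *\<^sub>R f (t A)) - b) < \<epsilon>)))"

definition has_RL_integral ::
    "'a set \<Rightarrow> 'a set set \<Rightarrow> ('a set \<Rightarrow> real) \<Rightarrow> ('a \<Rightarrow> 'b::banach) \<Rightarrow> 'b \<Rightarrow> bool" where
  "has_RL_integral T \<A> m f b \<longleftrightarrow>
    (\<forall>\<epsilon>>0. \<exists>P\<^sub>0. countable_partition T \<A> P\<^sub>0 \<and>
      (\<forall>P. countable_partition T \<A> P \<and> refines T P P\<^sub>0 \<longrightarrow>
        bounded_on_parts m f P \<and>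
        (\<forall>t. (\<forall>A\<in>P. t A \<in> A) \<longrightarrow>
          (\<lambda>A. m A *\<^sub>R f (t A)) summable_on P \<and>
          norm ((\<Sum>\<^sub>\<infinity>A\<in>P. m A *\<^sub>R f (t A)) - b) < \<epsilon>)))"

definition abs_RL_integrable ::
    "'a set \<Rightarrow> 'a set set \<Rightarrow> ('a set \<Rightarrow> real) \<Rightarrow> ('a \<Rightarrow> 'b::banach) \<Rightarrow> bool" where
  "abs_RL_integrable T \<A> m f \<longleftrightarrow> (\<exists>b. has_abs_RL_integral T \<A> m f b)"

definition RL_integrable ::
    "'a set \<Rightarrow> 'a set set \<Rightarrow> ('a set \<Rightarrow> real) \<Rightarrow> ('a \<Rightarrow> 'b::banach) \<Rightarrow> bool" where
  "RL_integrable T \<A> m f \<longleftrightarrow> (\<exists>b. has_RL_integral T \<A> m f b)"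

definition abs_RL_integral ::
    "'a set \<Rightarrow> 'a set set \<Rightarrow> ('a set \<Rightarrow> real) \<Rightarrow> ('a \<Rightarrow> 'b::banach) \<Rightarrow> 'b" where
  "abs_RL_integral T \<A> m f = (THE b. has_abs_RL_integral T \<A> m f b)"

definition RL_integral ::
    "'a set \<Rightarrow> 'a set set \<Rightarrow> ('a set \<Rightarrow> real) \<Rightarrow> ('a \<Rightarrow> 'b::banach) \<Rightarrow> 'b" where
  "RL_integral T \<A> m f = (THE b. has_RL_integral T \<A> m f b)"

end

theory Submission
  imports Defs "HOL-Analysis.Elementary_Normed_Spaces"
begin

text \<open>
  Both Riemann-Lebesgue integrals are limits of the sums
  \<open>\<Sum>\<^sub>\<infinity>A\<in>P. m A *\<^sub>R f (t A)\<close> along one filter, that of the tagged countable partitions ordered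
  by refinement of the partition. Two countable partitions have a countable common refinement,
  so this is a proper filter with an explicit base, and the \<open>\<epsilon>\<close>-condition of the definitions says:
  eventually \<open>f\<close> is bounded on the parts of positive measure and the series converges in the
  required mode, and its value tends to \<open>b\<close> (lemma \<open>has_RL_limit_iff\<close>).

  In this form uniqueness of the integral is uniqueness of limits. Linearity is linearity of limits:
  for a fixed tagged partition the series itself is linear in \<open>f\<close>, as long as its mode of
  convergence is stable under linear combinations and entails summability. Absolute and
  unconditional convergence both have these properties, so the argument is carried out once for an
  abstract mode of convergence. For the scaled set function, the series of \<open>f\<close> with respect to
  \<open>\<alpha> m\<close> is the series of \<open>\<alpha> f\<close> with respect to \<open>m\<close>.
\<close>

section \<open>The filter of tagged partitions\<close>

lemma ex_countable_partition:
  assumes "sigma_algebra T \<A>"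
  shows "\<exists>P. countable_partition T \<A> P"
proof -
  interpret sigma_algebra T \<A> by fact
  \<comment> \<open>If \<open>T\<close> is empty, this is the empty partition, since parts are nonempty.\<close>
  have "countable_partition T \<A> ({T} - {{}})"
    by (auto simp: countable_partition_def partition_on_def disjoint_def)
  then show ?thesis ..
qed

text \<open>Countability and measurability survive because every part of the common refinement is
  an intersection of one part of \<open>P\<close> with one part of \<open>Q\<close>.\<close>
lemma countable_partition_common_refinement:
  assumes "sigma_algebra T \<A>" "countable_partition T \<A> P" "countable_partition T \<A> Q"
  shows "countable_partition T \<A> (common_refinement {P, Q})"
proof -
  interpret sigma_algebra T \<A> by fact
  have sub: "common_refinement {P, Q} \<subseteq> (\<lambda>(A, B). A \<inter> B) ` (P \<times> Q)"
    by (auto simp: common_refinement)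
  have "countable (common_refinement {P, Q})"
    by (rule countable_subset[OF sub])
      (use assms in \<open>auto simp: countable_partition_def\<close>)
  moreover have "common_refinement {P, Q} \<subseteq> \<A>"
    using sub assms(2,3) by (fastforce simp: countable_partition_def)
  moreover have "partition_on T (common_refinement {P, Q})"
    by (rule partition_on_common_refinement) (use assms in \<open>auto simp: countable_partition_def\<close>)
  ultimately show ?thesis
    by (simp add: countable_partition_def)
qed

definition tagged_refinements ::
    "'a set \<Rightarrow> 'a set set \<Rightarrow> 'a set set \<Rightarrow> ('a set set \<times> ('a set \<Rightarrow> 'a)) set" where
  "tagged_refinements T \<A> P\<^sub>0 =
    {(P, t). countable_partition T \<A> P \<and> refines T P P\<^sub>0 \<and> (\<forall>A\<in>P. t A \<in> A)}"

definition refinement_filter ::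
    "'a set \<Rightarrow> 'a set set \<Rightarrow> ('a set set \<times> ('a set \<Rightarrow> 'a)) filter" where
  "refinement_filter T \<A> =
    (INF P\<^sub>0\<in>{P. countable_partition T \<A> P}. principal (tagged_refinements T \<A> P\<^sub>0))"

text \<open>Common refinements make the sets \<open>tagged_refinements T \<A> P\<^sub>0\<close> a directed family, hence a
  base of the filter that they generate.\<close>
lemma eventually_refinement_filter:
  assumes "sigma_algebra T \<A>"
  shows "eventually \<Phi> (refinement_filter T \<A>) \<longleftrightarrow>
    (\<exists>P\<^sub>0. countable_partition T \<A> P\<^sub>0 \<and> (\<forall>x\<in>tagged_refinements T \<A> P\<^sub>0. \<Phi> x))"
  unfolding refinement_filter_def
proof (subst eventually_INF_base)
  show "{P. countable_partition T \<A> P} \<noteq> {}"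
    using ex_countable_partition[OF assms] by simp
next
  fix P Q
  assume PQ: "P \<in> {P. countable_partition T \<A> P}" "Q \<in> {P. countable_partition T \<A> P}"
  let ?R = "common_refinement {P, Q}"
  have "refines T ?R P" "refines T ?R Q"
    by (rule refines_common_refinement; use PQ in \<open>auto simp: countable_partition_def\<close>)+
  then have "tagged_refinements T \<A> ?R \<subseteq> tagged_refinements T \<A> P \<inter> tagged_refinements T \<A> Q"
    by (auto simp: tagged_refinements_def intro: refines_trans)
  moreover have "countable_partition T \<A> ?R"
    using countable_partition_common_refinement[OF assms] PQ by simp
  ultimately show "\<exists>R\<in>{P. countable_partition T \<A> P}. principal (tagged_refinements T \<A> R)
      \<le> inf (principal (tagged_refinements T \<A> P)) (principal (tagged_refinements T \<A> Q))"
    by auto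
qed (auto simp: eventually_principal)

lemma ex_tags:
  assumes "countable_partition T \<A> P"
  obtains t where "\<forall>A\<in>P. t A \<in> A"
proof
  show "\<forall>A\<in>P. (SOME x. x \<in> A) \<in> A"
    using assms by (metis countable_partition_def partition_on_def some_in_eq)
qed

lemma refinement_filter_neq_bot:
  assumes "sigma_algebra T \<A>"
  shows "refinement_filter T \<A> \<noteq> bot"
proof
  assume "refinement_filter T \<A> = bot"
  then obtain P where P: "countable_partition T \<A> P" "tagged_refinements T \<A> P = {}"
    using eventually_refinement_filter[OF assms, of "\<lambda>_. False"] by fastforce
  obtain t where "\<forall>A\<in>P. t A \<in> A"
    using ex_tags[OF P(1)] .
  then have "(P, t) \<in> tagged_refinements T \<A> P"
    using P(1) by (auto simp: tagged_refinements_def countable_partition_def refines_refl)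
  with P(2) show False by simp
qed

section \<open>The integral as a limit\<close>

text \<open>\<open>C u P\<close> stands for convergence of the series of \<open>u\<close> over \<open>P\<close> in some mode, such as
  absolutely or unconditionally.\<close>
definition has_RL_limit ::
    "(('a set \<Rightarrow> 'b) \<Rightarrow> 'a set set \<Rightarrow> bool) \<Rightarrow> 'a set \<Rightarrow> 'a set set \<Rightarrow> ('a set \<Rightarrow> real) \<Rightarrow>
      ('a \<Rightarrow> 'b::banach) \<Rightarrow> 'b \<Rightarrow> bool" where
  "has_RL_limit C T \<A> m f b \<longleftrightarrow>
    (\<forall>\<^sub>F (P, t) in refinement_filter T \<A>.
      bounded_on_parts m f P \<and> C (\<lambda>A. m A *\<^sub>R f (t A)) P) \<and>
    ((\<lambda>(P, t). \<Sum>\<^sub>\<infinity>A\<in>P. m A *\<^sub>R f (t A)) \<longlongrightarrow> b) (refinement_filter T \<A>)"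

text \<open>Boundedness and convergence do not involve \<open>\<epsilon>\<close> and can be split off from the estimate.
  Boundedness may moreover be stated after the choice of tags, since every partition has tags.\<close>
lemma has_RL_limit_iff:
  assumes "sigma_algebra T \<A>"
  shows "has_RL_limit C T \<A> m f b \<longleftrightarrow>
    (\<forall>\<epsilon>>0. \<exists>P\<^sub>0. countable_partition T \<A> P\<^sub>0 \<and>
      (\<forall>P. countable_partition T \<A> P \<and> refines T P P\<^sub>0 \<longrightarrow>
        bounded_on_parts m f P \<and>
        (\<forall>t. (\<forall>A\<in>P. t A \<in> A) \<longrightarrow>
          C (\<lambda>A. m A *\<^sub>R f (t A)) P \<and>
          norm ((\<Sum>\<^sub>\<infinity>A\<in>P. m A *\<^sub>R f (t A)) - b) < \<epsilon>)))"
    (is "_ \<longleftrightarrow> (\<forall>\<epsilon>>0. ?approx \<epsilon>)")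
proof -
  let ?F = "refinement_filter T \<A>"
  let ?good = "\<lambda>(P, t). bounded_on_parts m f P \<and> C (\<lambda>A. m A *\<^sub>R f (t A)) P"
  let ?S = "\<lambda>(P, t). \<Sum>\<^sub>\<infinity>A\<in>P. m A *\<^sub>R f (t A)"
  have "?approx \<epsilon> \<longleftrightarrow> eventually (\<lambda>x. ?good x \<and> dist (?S x) b < \<epsilon>) ?F" for \<epsilon>
    unfolding eventually_refinement_filter[OF assms]
  proof (intro ex_cong1 conj_cong refl iffI ballI allI impI)
    fix P\<^sub>0 P
    assume *: "\<forall>x\<in>tagged_refinements T \<A> P\<^sub>0. ?good x \<and> dist (?S x) b < \<epsilon>"
      and P: "countable_partition T \<A> P \<and> refines T P P\<^sub>0"
    have **: "bounded_on_parts m f P \<and> C (\<lambda>A. m A *\<^sub>R f (t A)) P \<and>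
          norm ((\<Sum>\<^sub>\<infinity>A\<in>P. m A *\<^sub>R f (t A)) - b) < \<epsilon>" if "\<forall>A\<in>P. t A \<in> A" for t
      using *[rule_format, of "(P, t)"] P that by (simp add: tagged_refinements_def dist_norm)
    obtain t where "\<forall>A\<in>P. t A \<in> A"
      using P ex_tags by blast
    with ** show "bounded_on_parts m f P \<and> (\<forall>t. (\<forall>A\<in>P. t A \<in> A) \<longrightarrow>
        C (\<lambda>A. m A *\<^sub>R f (t A)) P \<and> norm ((\<Sum>\<^sub>\<infinity>A\<in>P. m A *\<^sub>R f (t A)) - b) < \<epsilon>)"
      by blast
  qed (auto simp: tagged_refinements_def dist_norm)
  then have "(\<forall>\<epsilon>>0. ?approx \<epsilon>) \<longleftrightarrow>
      (\<forall>\<epsilon>>0. eventually ?good ?F \<and> eventually (\<lambda>x. dist (?S x) b < \<epsilon>) ?F)"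
    by (simp add: eventually_conj_iff)
  also have "\<dots> \<longleftrightarrow> eventually ?good ?F \<and> (?S \<longlongrightarrow> b) ?F"
    unfolding tendsto_iff by (meson zero_less_one)
  finally show ?thesis
    by (simp add: has_RL_limit_def)
qed

lemma has_abs_RL_integral_eq:
  assumes "sigma_algebra T \<A>"
  shows "has_abs_RL_integral T \<A> m f = has_RL_limit (\<lambda>u P. u abs_summable_on P) T \<A> m f"
  by (rule ext) (simp only: has_RL_limit_iff[OF assms] has_abs_RL_integral_def)

lemma has_RL_integral_eq:
  assumes "sigma_algebra T \<A>"
  shows "has_RL_integral T \<A> m f = has_RL_limit (\<lambda>u P. u summable_on P) T \<A> m f"
  by (rule ext) (simp only: has_RL_limit_iff[OF assms] has_RL_integral_def)

lemma has_RL_limit_unique: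
  assumes "sigma_algebra T \<A>" "has_RL_limit C T \<A> m f b" "has_RL_limit C T \<A> m f c"
  shows "b = c"
  using assms(2,3) tendsto_unique[OF refinement_filter_neq_bot[OF assms(1)]]
  unfolding has_RL_limit_def by blast

lemma the_has_RL_limit:
  assumes "sigma_algebra T \<A>" "has_RL_limit C T \<A> m f b"
  shows "(THE b. has_RL_limit C T \<A> m f b) = b"
  using assms has_RL_limit_unique by blast

section \<open>Linearity for a mode of convergence\<close>

lemma bounded_on_parts_scaleR:
  "bounded_on_parts m f P \<Longrightarrow> bounded_on_parts m (\<lambda>x. c *\<^sub>R f x) P"
  unfolding bounded_on_parts_def by (auto intro: bounded_scaleR_comp)

lemma bounded_on_parts_add:
  "bounded_on_parts m f P \<Longrightarrow> bounded_on_parts m g P \<Longrightarrow> bounded_on_parts m (\<lambda>x. f x + g x) P"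
  unfolding bounded_on_parts_def by (auto intro: bounded_plus_comp)

text \<open>If \<open>c = 0\<close>, then \<open>c m\<close> is positive on no part; otherwise \<open>c m\<close> and \<open>m\<close> are positive on the same
  parts and the factor \<open>c\<close> in front of \<open>f\<close> can be divided out.\<close>
lemma bounded_on_parts_scale_measure:
  assumes "0 \<le> c" and bounded: "bounded_on_parts m (\<lambda>x. c *\<^sub>R f x) P"
  shows "bounded_on_parts (\<lambda>A. c * m A) f P"
  unfolding bounded_on_parts_def
proof (intro ballI impI)
  fix A assume A: "A \<in> P" "0 < c * m A"
  then have "0 < c" "0 < m A"
    using assms(1) by (auto simp: zero_less_mult_iff)
  then have "bounded ((\<lambda>x. c *\<^sub>R f x) ` A)"
    using bounded A(1) by (auto simp: bounded_on_parts_def)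
  from bounded_scaleR_comp[OF this, of "inverse c"] show "bounded (f ` A)"
    using \<open>0 < c\<close> by simp
qed

locale linear_convergence_mode =
  fixes C :: "('a set \<Rightarrow> 'b::banach) \<Rightarrow> 'a set set \<Rightarrow> bool"
  assumes summable: "C u P \<Longrightarrow> u summable_on P"
    and scaleR: "C u P \<Longrightarrow> C (\<lambda>A. c *\<^sub>R u A) P"
    and add: "C u P \<Longrightarrow> C v P \<Longrightarrow> C (\<lambda>A. u A + v A) P"
begin

lemma has_RL_limit_scaleR:
  assumes "has_RL_limit C T \<A> m f b"
  shows "has_RL_limit C T \<A> m (\<lambda>x. c *\<^sub>R f x) (c *\<^sub>R b)"
proof -
  let ?F = "refinement_filter T \<A>"
  have swap: "m A *\<^sub>R c *\<^sub>R f x = c *\<^sub>R m A *\<^sub>R f x" for A x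
    by (simp add: mult.commute)
  have "\<forall>\<^sub>F (P, t) in ?F. bounded_on_parts m f P \<and> C (\<lambda>A. m A *\<^sub>R f (t A)) P"
    using assms unfolding has_RL_limit_def by blast
  then have "\<forall>\<^sub>F (P, t) in ?F. bounded_on_parts m (\<lambda>x. c *\<^sub>R f x) P \<and>
      C (\<lambda>A. m A *\<^sub>R c *\<^sub>R f (t A)) P"
    unfolding swap
    by eventually_elim (auto intro: scaleR bounded_on_parts_scaleR simp del: scaleR_scaleR)
  moreover have "((\<lambda>x. c *\<^sub>R (case x of (P, t) \<Rightarrow> \<Sum>\<^sub>\<infinity>A\<in>P. m A *\<^sub>R f (t A))) \<longlongrightarrow> c *\<^sub>R b) ?F"
    by (intro tendsto_intros) (use assms in \<open>simp add: has_RL_limit_def\<close>)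
  then have "((\<lambda>(P, t). \<Sum>\<^sub>\<infinity>A\<in>P. m A *\<^sub>R c *\<^sub>R f (t A)) \<longlongrightarrow> c *\<^sub>R b) ?F"
    unfolding swap infsum_scaleR_right by (simp add: case_prod_unfold)
  ultimately show ?thesis
    unfolding has_RL_limit_def by blast
qed

text \<open>Additivity of the series needs summability of both, so the value of the sum for \<open>f + g\<close> is
  known only eventually, that is, for sufficiently fine partitions.\<close>
lemma has_RL_limit_add:
  assumes "has_RL_limit C T \<A> m f b" "has_RL_limit C T \<A> m g c"
  shows "has_RL_limit C T \<A> m (\<lambda>x. f x + g x) (b + c)"
proof -
  let ?F = "refinement_filter T \<A>"
  let ?S = "\<lambda>h (P, t). \<Sum>\<^sub>\<infinity>A\<in>P. m A *\<^sub>R h (t A)"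
  have good: "\<forall>\<^sub>F (P, t) in ?F. bounded_on_parts m f P \<and> C (\<lambda>A. m A *\<^sub>R f (t A)) P"
    "\<forall>\<^sub>F (P, t) in ?F. bounded_on_parts m g P \<and> C (\<lambda>A. m A *\<^sub>R g (t A)) P"
    using assms unfolding has_RL_limit_def by blast+
  from good have "\<forall>\<^sub>F (P, t) in ?F. bounded_on_parts m (\<lambda>x. f x + g x) P \<and>
      C (\<lambda>A. m A *\<^sub>R (f (t A) + g (t A))) P"
    unfolding scaleR_add_right
    by eventually_elim (auto intro: add bounded_on_parts_add)
  moreover have "(?S (\<lambda>x. f x + g x) \<longlongrightarrow> b + c) ?F"
  proof (rule Lim_transform_eventually)
    show "((\<lambda>x. ?S f x + ?S g x) \<longlongrightarrow> b + c) ?F"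
      by (intro tendsto_intros) (use assms in \<open>simp_all add: has_RL_limit_def\<close>)
    from good show "\<forall>\<^sub>F x in ?F. ?S f x + ?S g x = ?S (\<lambda>x. f x + g x) x"
      by eventually_elim (auto simp: scaleR_add_right infsum_add summable)
  qed
  ultimately show ?thesis
    unfolding has_RL_limit_def by blast
qed

lemma has_RL_limit_diff:
  assumes "has_RL_limit C T \<A> m f b" "has_RL_limit C T \<A> m g c"
  shows "has_RL_limit C T \<A> m (\<lambda>x. f x - g x) (b - c)"
  using has_RL_limit_add[OF assms(1) has_RL_limit_scaleR[OF assms(2), of "-1"]] by simp

text \<open>The series of \<open>f\<close> with respect to \<open>c m\<close> coincides with that of \<open>c f\<close> with respect to \<open>m\<close>;
  only boundedness is affected, through the meaning of positive measure.\<close>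
lemma has_RL_limit_scale_measure:
  assumes "0 \<le> c" "has_RL_limit C T \<A> m f b"
  shows "has_RL_limit C T \<A> (\<lambda>A. c * m A) f (c *\<^sub>R b)"
proof -
  have swap: "m A *\<^sub>R c *\<^sub>R f x = (c * m A) *\<^sub>R f x" for A x
    by (simp add: mult.commute)
  have lim: "has_RL_limit C T \<A> m (\<lambda>x. c *\<^sub>R f x) (c *\<^sub>R b)"
    using assms(2) by (rule has_RL_limit_scaleR)
  then have "\<forall>\<^sub>F (P, t) in refinement_filter T \<A>.
      bounded_on_parts m (\<lambda>x. c *\<^sub>R f x) P \<and> C (\<lambda>A. (c * m A) *\<^sub>R f (t A)) P"
    unfolding has_RL_limit_def swap by blast
  then have "\<forall>\<^sub>F (P, t) in refinement_filter T \<A>.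
      bounded_on_parts (\<lambda>A. c * m A) f P \<and> C (\<lambda>A. (c * m A) *\<^sub>R f (t A)) P"
    by eventually_elim (auto intro: bounded_on_parts_scale_measure[OF assms(1)])
  with lim show ?thesis
    unfolding has_RL_limit_def swap by blast
qed

lemma RL_limit_linear:
  fixes \<alpha> :: real
  assumes "sigma_algebra T \<A>"
  defines "integrable \<equiv> \<lambda>m f. \<exists>b. has_RL_limit C T \<A> m f b"
    and "integral \<equiv> \<lambda>m f. THE b. has_RL_limit C T \<A> m f b"
  assumes f: "integrable m f" and g: "integrable m g"
  shows "integrable m (\<lambda>x. \<alpha> *\<^sub>R f x) \<and> integral m (\<lambda>x. \<alpha> *\<^sub>R f x) = \<alpha> *\<^sub>R integral m f"
    and "0 \<le> \<alpha> \<Longrightarrow>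
      integrable (\<lambda>A. \<alpha> * m A) f \<and> integral (\<lambda>A. \<alpha> * m A) f = \<alpha> *\<^sub>R integral m f"
    and "integrable m (\<lambda>x. f x + g x) \<and>
      integral m (\<lambda>x. f x + g x) = integral m f + integral m g"
    and "integrable m (\<lambda>x. f x - g x) \<and>
      integral m (\<lambda>x. f x - g x) = integral m f - integral m g"
proof -
  have eqI: "integrable m' h \<and> integral m' h = b" if "has_RL_limit C T \<A> m' h b" for m' h b
    using that the_has_RL_limit[OF assms(1) that] unfolding integrable_def integral_def by blast
  obtain b c where "has_RL_limit C T \<A> m f b" "has_RL_limit C T \<A> m g c"
    using f g unfolding integrable_def by blast
  then have *: "has_RL_limit C T \<A> m f (integral m f)" "has_RL_limit C T \<A> m g (integral m g)"
    using eqI by blast+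
  show "integrable m (\<lambda>x. \<alpha> *\<^sub>R f x) \<and> integral m (\<lambda>x. \<alpha> *\<^sub>R f x) = \<alpha> *\<^sub>R integral m f"
    by (intro eqI has_RL_limit_scaleR *)
  show "integrable (\<lambda>A. \<alpha> * m A) f \<and> integral (\<lambda>A. \<alpha> * m A) f = \<alpha> *\<^sub>R integral m f" if "0 \<le> \<alpha>"
    by (intro eqI has_RL_limit_scale_measure * that)
  show "integrable m (\<lambda>x. f x + g x) \<and>
      integral m (\<lambda>x. f x + g x) = integral m f + integral m g"
    by (intro eqI has_RL_limit_add *)
  show "integrable m (\<lambda>x. f x - g x) \<and>
      integral m (\<lambda>x. f x - g x) = integral m f - integral m g"
    by (intro eqI has_RL_limit_diff *)
qed

end

section \<open>The absolute and the unconditional integral\<close>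

interpretation absolute: linear_convergence_mode "\<lambda>u P. u abs_summable_on P"
proof
  fix u v :: "'a set \<Rightarrow> 'b" and P c
  show "u summable_on P" if "u abs_summable_on P"
    using that by (rule abs_summable_summable)
  show "(\<lambda>A. c *\<^sub>R u A) abs_summable_on P" if "u abs_summable_on P"
    using that by (simp add: summable_on_cmult_right)
  show "(\<lambda>A. u A + v A) abs_summable_on P" if "u abs_summable_on P" "v abs_summable_on P"
    by (rule summable_on_comparison_test[OF summable_on_add[OF that]])
      (auto intro: norm_triangle_ineq)
qed

interpretation unconditional: linear_convergence_mode "\<lambda>u P. u summable_on P"
  by standard (auto intro: summable_on_add)

theorem theorem3p5:
  fixes T :: "'a set" and \<A> :: "'a set set" and m :: "'a set \<Rightarrow> real"
    and f g :: "'a \<Rightarrow> 'b::banach" and \<alpha> :: real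
  assumes "infinite T"
    and "sigma_algebra T \<A>"
    and "m {} = 0"
    and "\<And>A. A \<in> \<A> \<Longrightarrow> 0 \<le> m A"
  shows
    "(abs_RL_integrable T \<A> m f \<and> abs_RL_integrable T \<A> m g \<longrightarrow>
        (abs_RL_integrable T \<A> m (\<lambda>x. \<alpha> *\<^sub>R f x) \<and>
         abs_RL_integral T \<A> m (\<lambda>x. \<alpha> *\<^sub>R f x) = \<alpha> *\<^sub>R abs_RL_integral T \<A> m f) \<and>
        (0 \<le> \<alpha> \<longrightarrow>
         abs_RL_integrable T \<A> (\<lambda>A. \<alpha> * m A) f \<and>
         abs_RL_integral T \<A> (\<lambda>A. \<alpha> * m A) f = \<alpha> *\<^sub>R abs_RL_integral T \<A> m f) \<and>
        (abs_RL_integrable T \<A> m (\<lambda>x. f x + g x) \<and>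
         abs_RL_integral T \<A> m (\<lambda>x. f x + g x) =
           abs_RL_integral T \<A> m f + abs_RL_integral T \<A> m g \<and>
         abs_RL_integrable T \<A> m (\<lambda>x. f x - g x) \<and>
         abs_RL_integral T \<A> m (\<lambda>x. f x - g x) =
           abs_RL_integral T \<A> m f - abs_RL_integral T \<A> m g)) \<and>
     (RL_integrable T \<A> m f \<and> RL_integrable T \<A> m g \<longrightarrow>
        (RL_integrable T \<A> m (\<lambda>x. \<alpha> *\<^sub>R f x) \<and>
         RL_integral T \<A> m (\<lambda>x. \<alpha> *\<^sub>R f x) = \<alpha> *\<^sub>R RL_integral T \<A> m f) \<and>
        (0 \<le> \<alpha> \<longrightarrow>
         RL_integrable T \<A> (\<lambda>A. \<alpha> * m A) f \<and>
         RL_integral T \<A> (\<lambda>A. \<alpha> * m A) f = \<alpha> *\<^sub>R RL_integral T \<A> m f) \<and>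
        (RL_integrable T \<A> m (\<lambda>x. f x + g x) \<and>
         RL_integral T \<A> m (\<lambda>x. f x + g x) = RL_integral T \<A> m f + RL_integral T \<A> m g \<and>
         RL_integrable T \<A> m (\<lambda>x. f x - g x) \<and>
         RL_integral T \<A> m (\<lambda>x. f x - g x) = RL_integral T \<A> m f - RL_integral T \<A> m g))"
  unfolding abs_RL_integrable_def abs_RL_integral_def RL_integrable_def RL_integral_def
    has_abs_RL_integral_eq[OF assms(2)] has_RL_integral_eq[OF assms(2)]
  using absolute.RL_limit_linear[OF assms(2), where m = m and f = f and g = g]
    unconditional.RL_limit_linear[OF assms(2), where m = m and f = f and g = g]
  by blast

end
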